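(* Let $\rho>0$, $\beta>0$ and $\alpha\in[0,1)$. (a) The radius of convexity of order $\alpha$ of $f_{\rho,\beta}$, $r^{c}_{\alpha}(f_{\rho,\beta})$, is the smallest positive root $r$ of $$1+\frac{r\Psi''_{\rho,\beta}(r)}{\Psi'_{\rho,\beta}(r)}+\left(\frac{1}{\beta}-1\right)\frac{r\Psi'_{\rho,\beta}(r)}{\Psi_{\rho,\beta}(r)}=\alpha,$$ where $\Psi_{\rho,\beta}(z)=z^{\beta}\lambda_{\rho,\beta}(z)$. (b) The radius of convexity of order $\alpha$ of $g_{\rho,\beta}$, $r^{c}_{\alpha}(g_{\rho,\beta})$, is the smallest positive root $r$ of $$1+\frac{rg_{\rho,\beta}''(r)}{g_{\rho,\beta}'(r)}=\alpha.$$ (c) The radius of convexity of order $\alpha$ of $h_{\rho,\beta}$, $r^{c}_{\alpha}(h_{\rho,\beta})$, is the smallest positive root $r$ of $$1+\frac{rh_{\rho,\beta}''(r)}{h_{\rho,\beta}'(r)}=\alpha.$$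
   Context: The Wright function is the entire function (of $z$) $\phi(\rho,\beta,z)=\sum_{n\ge 0}\frac{z^n}{n!\,\Gamma(n\rho+\beta)}$. Put $\lambda_{\rho,\beta}(z)=\phi(\rho,\beta,-z^2)$, and define $$f_{\rho,\beta}(z)=\left(z^{\beta}\Gamma(\beta)\phi(\rho,\beta,-z^2)\right)^{1/\beta},\quad g_{\rho,\beta}(z)=z\,\Gamma(\beta)\phi(\rho,\beta,-z^2),\quad h_{\rho,\beta}(z)=z\,\Gamma(\beta)\phi(\rho,\beta,-z).$$ Here $f_{\rho,\beta}$ is understood as $z\,(\Gamma(\beta)\phi(\rho,\beta,-z^2))^{1/\beta}$, analytic near $0$ with the branch of the power equal to $1$ at $z=0$, so that $f_{\rho,\beta}(0)=0$, $f_{\rho,\beta}'(0)=1$. The function $\Psi_{\rho,\beta}$ is considered on $(0,\infty)$ with $r^\beta>0$. For $r>0$ let $\mathbb{D}_r=\{z\in\mathbb{C}:|z|<r\}$. For an analytic $f$ normalized by $f(0)=f'(0)-1=0$ and $\alpha\in[0,1)$, the radius of convexity of order $\alpha$ is $$r^{c}_{\alpha}(f)=\sup\left\{r>0:\ \operatorname{Re}\left(1+\frac{zf''(z)}{f'(z)}\right)>\alpha\ \text{for all } z\in\mathbb{D}_r\right\}.$$ *)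

theory Defs
  imports "HOL-Complex_Analysis.Complex_Analysis"
begin

definition wright :: "real \<Rightarrow> real \<Rightarrow> 'a \<Rightarrow> 'a::{real_normed_field, banach}" where
  "wright \<rho> \<beta> z = (\<Sum>n. z ^ n / (fact n * of_real (Gamma (real n * \<rho> + \<beta>))))"

definition wright_lambda :: "real \<Rightarrow> real \<Rightarrow> 'a \<Rightarrow> 'a::{real_normed_field, banach}" where
  "wright_lambda \<rho> \<beta> z = wright \<rho> \<beta> (- (z ^ 2))"

definition wright_Psi :: "real \<Rightarrow> real \<Rightarrow> real \<Rightarrow> real" where
  "wright_Psi \<rho> \<beta> r = r powr \<beta> * wright_lambda \<rho> \<beta> r"

text \<open>
  The base of the power is \<open>1\<close> at \<open>z = 0\<close>, so near \<open>0\<close> the principal power is the analytic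
  branch with value \<open>1\<close> there.  Farther from \<open>0\<close> the principal power can jump where the base
  crosses the negative real axis; only the germ of this function at \<open>0\<close> is used below.
\<close>
definition wright_f :: "real \<Rightarrow> real \<Rightarrow> complex \<Rightarrow> complex" where
  "wright_f \<rho> \<beta> z =
     z * (of_real (Gamma \<beta>) * wright \<rho> \<beta> (- (z ^ 2))) powr of_real (1 / \<beta>)"

definition wright_g :: "real \<Rightarrow> real \<Rightarrow> complex \<Rightarrow> complex" where
  "wright_g \<rho> \<beta> z = z * of_real (Gamma \<beta>) * wright \<rho> \<beta> (- (z ^ 2))"

definition wright_h :: "real \<Rightarrow> real \<Rightarrow> complex \<Rightarrow> complex" where
  "wright_h \<rho> \<beta> z = z * of_real (Gamma \<beta>) * wright \<rho> \<beta> (- z)"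

text \<open>
  The conjunct on the derivative says that the quotient is defined; without it the convention
  \<open>x / 0 = 0\<close> would make the inequality true at the critical points.
\<close>
definition convex_of_order_on :: "real \<Rightarrow> complex set \<Rightarrow> (complex \<Rightarrow> complex) \<Rightarrow> bool" where
  "convex_of_order_on \<alpha> S f \<longleftrightarrow>
     (\<forall>z\<in>S. deriv f z \<noteq> 0 \<and> Re (1 + z * deriv (deriv f) z / deriv f z) > \<alpha>)"

text \<open>
  An analytic function near \<open>0\<close> is identified with its (unique) analytic continuation \<open>F\<close> to the
  disc in question; for a function that is already holomorphic on the disc, \<open>F\<close> can be taken to be
  the function itself (see the lemmas below).  The supremum is taken in the extended reals, so that
  it is \<open>\<infinity>\<close> when the radii are unbounded.
\<close>
definition convexity_radius :: "real \<Rightarrow> (complex \<Rightarrow> complex) \<Rightarrow> ereal" where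
  "convexity_radius \<alpha> f =
     (SUP r \<in> {r. 0 < r \<and>
                  (\<exists>F. F holomorphic_on ball 0 r \<and> (\<forall>\<^sub>F z in nhds 0. F z = f z) \<and>
                       convex_of_order_on \<alpha> (ball 0 r) F)}. ereal r)"

definition smallest_positive :: "(real \<Rightarrow> bool) \<Rightarrow> real \<Rightarrow> bool" where
  "smallest_positive P r \<longleftrightarrow> 0 < r \<and> P r \<and> (\<forall>s. 0 < s \<and> s < r \<longrightarrow> \<not> P s)"

lemma convex_of_order_on_cong:
  assumes "open S" and eq: "\<And>z. z \<in> S \<Longrightarrow> F z = f z"
  shows "convex_of_order_on \<alpha> S F \<longleftrightarrow> convex_of_order_on \<alpha> S f"
proof -
  have ev: "\<forall>\<^sub>F w in nhds z. w \<in> S" if "z \<in> S" for z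
    using assms(1) that by (rule eventually_nhds_in_open)
  have d1: "deriv F z = deriv f z" if "z \<in> S" for z
    by (rule deriv_cong_ev) (use ev[OF that] eq in \<open>auto elim!: eventually_mono\<close>)
  have d2: "deriv (deriv F) z = deriv (deriv f) z" if "z \<in> S" for z
    by (rule deriv_cong_ev) (use ev[OF that] d1 in \<open>auto elim!: eventually_mono\<close>)
  show ?thesis
    unfolding convex_of_order_on_def using d1 d2 by simp
qed

lemma continuation_convex_iff:
  assumes "0 < r" and hol: "f holomorphic_on ball 0 r"
  shows "(\<exists>F. F holomorphic_on ball 0 r \<and> (\<forall>\<^sub>F z in nhds 0. F z = f z) \<and>
              convex_of_order_on \<alpha> (ball 0 r) F)
         \<longleftrightarrow> convex_of_order_on \<alpha> (ball 0 r) f"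
proof
  assume "\<exists>F. F holomorphic_on ball 0 r \<and> (\<forall>\<^sub>F z in nhds 0. F z = f z) \<and>
              convex_of_order_on \<alpha> (ball 0 r) F"
  then obtain F where F: "F holomorphic_on ball 0 r" "\<forall>\<^sub>F z in nhds 0. F z = f z"
    "convex_of_order_on \<alpha> (ball 0 r) F" by blast
  obtain e where e: "e > 0" "\<And>z. dist z 0 < e \<Longrightarrow> F z = f z"
    using F(2) unfolding eventually_nhds_metric by blast
  define d where "d = min e r"
  have "F z = f z" if "z \<in> ball 0 r" for z
  proof (rule analytic_continuation_open[where s = "ball 0 d" and s' = "ball 0 r" and f = F and g = f])
    show "ball (0::complex) d \<noteq> {}"
      using e(1) assms(1) by (simp add: d_def)
  qed (use F(1) hol e that in \<open>auto simp: d_def dist_commute\<close>)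
  with F(3) show "convex_of_order_on \<alpha> (ball 0 r) f"
    using convex_of_order_on_cong[of "ball 0 r" F f \<alpha>] by simp
next
  assume "convex_of_order_on \<alpha> (ball 0 r) f"
  with hol show "\<exists>F. F holomorphic_on ball 0 r \<and> (\<forall>\<^sub>F z in nhds 0. F z = f z) \<and>
              convex_of_order_on \<alpha> (ball 0 r) F"
    by (intro exI[of _ f]) simp
qed

lemma convexity_radius_entire:
  assumes "f holomorphic_on UNIV"
  shows "convexity_radius \<alpha> f =
           (SUP r \<in> {r. 0 < r \<and> convex_of_order_on \<alpha> (ball 0 r) f}. ereal r)"
proof -
  have "f holomorphic_on ball 0 r" for r
    using assms by (rule holomorphic_on_subset) simp
  then have "{r. 0 < r \<and> (\<exists>F. F holomorphic_on ball 0 r \<and> (\<forall>\<^sub>F z in nhds 0. F z = f z) \<and>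
                 convex_of_order_on \<alpha> (ball 0 r) F)} =
             {r. 0 < r \<and> convex_of_order_on \<alpha> (ball 0 r) f}"
    by (intro Collect_cong conj_cong refl continuation_convex_iff)
  then show ?thesis
    unfolding convexity_radius_def by (rule arg_cong)
qed

end

theory Submission
  imports Defs
begin

text \<open>
  Everything is read off from Taylor coefficients.  Let \<open>l(w) = \<phi>(\<rho>, \<beta>, -w)\<close>.  If \<open>- w l' / l\<close> has
  nonnegative coefficients, then so has \<open>- w m' / m\<close> for \<open>m = b l + c w l'\<close>; starting from
  \<open>exp (- c w)\<close> and letting Gauss's product for \<open>1 / \<Gamma>\<close> act on the coefficients, one sees that
  \<open>- w l' / l\<close> has nonnegative coefficients (no information on the zeros of \<open>l\<close> is needed).
  Each of \<open>f, g, h\<close> is a function \<open>F\<close> with \<open>z F' / F = 1 - T\<close> and \<open>T\<close> a series with nonnegative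
  coefficients, so that \<open>1 + z F'' / F' = 1 - A\<close> with \<open>A = T + z T' / (1 - T)\<close> again nonnegative.
  Thus \<open>\<bar>A(z)\<bar> \<le> A(\<bar>z\<bar>)\<close>, the function \<open>A\<close> is increasing on the positive axis, and the radius of
  convexity is the root of \<open>A(r) = 1 - \<alpha>\<close>.  The root exists because \<open>A\<close> is meromorphic in the
  plane: if \<open>A < 1\<close> held up to its radius of convergence, the denominator would be bounded away
  from \<open>0\<close> and \<open>A\<close> would converge in a larger disc.
\<close>

subsection \<open>Logarithmic derivatives with nonnegative coefficients\<close>

definition nonneg_fps :: "real fps \<Rightarrow> bool" where
  "nonneg_fps S \<longleftrightarrow> (\<forall>n. fps_nth S n \<ge> 0)"

lemma nonneg_fps_add: "nonneg_fps S \<Longrightarrow> nonneg_fps T \<Longrightarrow> nonneg_fps (S + T)"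
  by (simp add: nonneg_fps_def)

lemma nonneg_fps_mult: "nonneg_fps S \<Longrightarrow> nonneg_fps T \<Longrightarrow> nonneg_fps (S * T)"
  by (auto simp: nonneg_fps_def fps_mult_nth intro!: sum_nonneg)

lemma nonneg_fps_const: "c \<ge> 0 \<Longrightarrow> nonneg_fps (fps_const c)"
  by (simp add: nonneg_fps_def)

lemma nonneg_fps_X: "nonneg_fps fps_X"
  by (simp add: nonneg_fps_def fps_X_def)

lemma nonneg_fps_power: "nonneg_fps S \<Longrightarrow> nonneg_fps (S ^ n)"
  by (induction n) (auto intro: nonneg_fps_mult nonneg_fps_const[of 1, simplified])

lemma nonneg_fps_deriv: "nonneg_fps S \<Longrightarrow> nonneg_fps (fps_deriv S)"
  by (simp add: nonneg_fps_def)

lemma nonneg_fps_compose: "nonneg_fps S \<Longrightarrow> nonneg_fps T \<Longrightarrow> nonneg_fps (S oo T)"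
  using nonneg_fps_power[of T]
  by (auto simp: nonneg_fps_def fps_compose_nth intro!: sum_nonneg)

text \<open>The inverse is the geometric series of the powers \<open>S ^ n / c ^ (n + 1)\<close>.
  The proof reads this off the recursion for the coefficients of an inverse: the minus sign there
  cancels the one in front of \<open>S\<close>.\<close>

lemma nonneg_fps_inverse_const_minus:
  assumes "c > 0" "nonneg_fps S" "fps_nth S 0 = 0"
  shows "nonneg_fps (inverse (fps_const c - S))"
proof -
  let ?u = "fps_const c - S"
  have u0: "fps_nth ?u 0 = c"
    using assms by simp
  have "fps_nth (inverse ?u) n \<ge> 0" for n
  proof (induction n rule: less_induct)
    case (less n)
    show ?case
    proof (cases "n = 0")
      case True
      with assms u0 show ?thesis by simp
    next
      case False
      have "fps_nth (inverse ?u) n = inverse c * (\<Sum>i=1..n. fps_nth S i * fps_nth (inverse ?u) (n - i))"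
        using False u0 unfolding fps_inverse_def
        by (cases n) (simp_all add: sum_negf algebra_simps)
      also have "\<dots> \<ge> 0"
        using assms less by (intro mult_nonneg_nonneg sum_nonneg) (auto simp: nonneg_fps_def)
      finally show ?thesis .
    qed
  qed
  then show ?thesis
    by (simp add: nonneg_fps_def)
qed

text \<open>For a finite product of factors \<open>1 - X / a\<close> with \<open>a > 0\<close> the
  series tested here is the sum of \<open>X / (a - X)\<close>, whose coefficients are power sums of
  the \<open>1 / a\<close>. The condition keeps this consequence of having positive zeros and speaks
  of coefficients only. The positive constant term makes the formal inverse a genuine one.\<close>

definition nonneg_log_deriv :: "real fps \<Rightarrow> bool" where
  "nonneg_log_deriv l \<longleftrightarrow>
     fps_nth l 0 > 0 \<and> nonneg_fps (- (fps_X * fps_deriv l * inverse l))"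

text \<open>Division-free form: as \<open>l\<close> is invertible, the identity determines
  \<open>S\<close> as the negative logarithmic derivative.\<close>

lemma nonneg_log_derivI:
  assumes "fps_nth l 0 > 0" "nonneg_fps S" "fps_X * fps_deriv l = - (S * l)"
  shows "nonneg_log_deriv l"
proof -
  have "S * (l * inverse l) = S"
    using inverse_mult_eq_1'[of l] assms(1) by simp
  then have "- (fps_X * fps_deriv l * inverse l) = S"
    unfolding assms(3) by (simp only: mult.assoc minus_mult_left minus_minus)
  then show ?thesis
    using assms by (simp only: nonneg_log_deriv_def simp_thms)
qed

lemma nonneg_log_derivE:
  assumes "nonneg_log_deriv l"
  obtains S where "fps_nth l 0 > 0" "nonneg_fps S" "fps_nth S 0 = 0"
    "fps_X * fps_deriv l = - (S * l)"
proof -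
  let ?S = "- (fps_X * fps_deriv l * inverse l)"
  have "?S * l = - (fps_X * fps_deriv l)"
    using inverse_mult_eq_1[of l] assms by (simp add: nonneg_log_deriv_def mult.assoc)
  moreover have "fps_nth ?S 0 = 0"
    by (simp add: mult.assoc)
  ultimately show ?thesis
    using that[of ?S] assms by (simp add: nonneg_log_deriv_def)
qed

text \<open>
  Writing \<open>S = - X l' / l\<close>, the new series is \<open>l (b - c S)\<close>, whose logarithmic derivative gives
  \<open>S + c X S' / (b - c S)\<close>.
\<close>
lemma nonneg_log_deriv_euler:
  assumes l: "nonneg_log_deriv l" and "b > 0" "c \<ge> 0"
  shows "nonneg_log_deriv (fps_const b * l + fps_const c * (fps_X * fps_deriv l))"
    (is "nonneg_log_deriv ?m")
proof -
  obtain S where S: "fps_nth l 0 > 0" "nonneg_fps S" "fps_nth S 0 = 0"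
    "fps_X * fps_deriv l = - (S * l)"
    using nonneg_log_derivE[OF l] by metis
  define v where "v = fps_const b - fps_const c * S"
  define W where "W = fps_const c * (fps_X * fps_deriv S) * inverse v"
  have m: "?m = l * v"
    by (simp add: v_def S(4) algebra_simps)
  have cS: "nonneg_fps (fps_const c * S)"
    using assms S by (intro nonneg_fps_mult nonneg_fps_const)
  have inv: "nonneg_fps (inverse v)"
    unfolding v_def using assms S cS by (intro nonneg_fps_inverse_const_minus) auto
  have "fps_nth v 0 \<noteq> 0"
    using assms S by (simp add: v_def)
  then have Wv: "W * v = fps_const c * (fps_X * fps_deriv S)"
    using inverse_mult_eq_1[of v] by (simp add: W_def mult.assoc)
  have "fps_X * fps_deriv (l * v) = (fps_X * fps_deriv l) * v + l * (fps_X * fps_deriv v)"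
    by (simp add: algebra_simps)
  also have "fps_X * fps_deriv v = - (W * v)"
    by (simp add: Wv) (simp add: v_def algebra_simps)
  also have "(fps_X * fps_deriv l) * v + l * - (W * v) = - ((S + W) * (l * v))"
    by (simp add: S(4) algebra_simps)
  finally have "fps_X * fps_deriv ?m = - ((S + W) * ?m)"
    by (simp only: m)
  moreover have "nonneg_fps (S + W)"
    unfolding W_def using S assms inv
    by (intro nonneg_fps_add nonneg_fps_mult nonneg_fps_const nonneg_fps_X nonneg_fps_deriv)
  moreover have "fps_nth ?m 0 > 0"
    using S assms by simp
  ultimately show ?thesis
    by (intro nonneg_log_derivI)
qed

section \<open>Coefficientwise limits and Gauss's product\<close>

lemma tendsto_fps_inverse_nth:
  fixes F :: "nat \<Rightarrow> real fps"
  assumes "\<And>n. (\<lambda>k. fps_nth (F k) n) \<longlonglongrightarrow> fps_nth f n" "fps_nth f 0 \<noteq> 0"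
  shows "(\<lambda>k. fps_nth (inverse (F k)) n) \<longlonglongrightarrow> fps_nth (inverse f) n"
proof (induction n rule: less_induct)
  case (less n)
  have rec: "fps_nth (inverse g) n =
      - inverse (fps_nth g 0) * (\<Sum>i=1..n. fps_nth g i * fps_nth (inverse g) (n - i))"
    if "n \<noteq> 0" for g :: "real fps"
    using that unfolding fps_inverse_def by (cases n) simp_all
  show ?case
  proof (cases "n = 0")
    case True
    then show ?thesis
      using assms by (auto intro!: tendsto_intros)
  next
    case False
    show ?thesis
      unfolding rec[OF False] using assms less by (intro tendsto_intros) auto
  qed
qed

text \<open>Each coefficient of the logarithmic derivative is a continuous function of finitely many
  coefficients of the series, so its sign survives coefficientwise limits. Positivity of the
  constant term is assumed because a limit of positive numbers may vanish.\<close>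

lemma nonneg_log_deriv_limit:
  assumes l: "\<And>k. nonneg_log_deriv (F k)"
    and lim: "\<And>n. (\<lambda>k. fps_nth (F k) n) \<longlonglongrightarrow> fps_nth f n" and "fps_nth f 0 > 0"
  shows "nonneg_log_deriv f"
proof -
  have "fps_nth (- (fps_X * fps_deriv f * inverse f)) n \<ge> 0" for n
  proof (rule LIMSEQ_le_const)
    have d: "(\<lambda>k. fps_nth (fps_X * fps_deriv (F k)) n) \<longlonglongrightarrow> fps_nth (fps_X * fps_deriv f) n" for n
      by (cases n) (auto intro!: tendsto_intros lim simp del: of_nat_Suc)
    show "(\<lambda>k. fps_nth (- (fps_X * fps_deriv (F k) * inverse (F k))) n)
        \<longlonglongrightarrow> fps_nth (- (fps_X * fps_deriv f * inverse f)) n"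
      unfolding fps_neg_nth fps_mult_nth[of "fps_X * fps_deriv g" for g]
      by (intro tendsto_intros d tendsto_fps_inverse_nth lim) (use assms in auto)
    show "\<exists>N. \<forall>k\<ge>N. 0 \<le> fps_nth (- (fps_X * fps_deriv (F k) * inverse (F k))) n"
      using l by (auto simp: nonneg_log_deriv_def nonneg_fps_def simp del: fps_neg_nth)
  qed
  then show ?thesis
    using assms by (simp add: nonneg_log_deriv_def nonneg_fps_def)
qed

text \<open>Multiplying the coefficient at \<open>n\<close> by \<open>n \<rho> + \<beta> + k\<close>
  is the action of the operator \<open>(\<beta> + k) + \<rho> X d/dX\<close>, so each further
  Pochhammer factor is one use of \<open>nonneg_log_deriv_euler\<close>. The start is
  \<open>exp (- c X)\<close>, with \<open>S = c X\<close>.\<close>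

lemma nonneg_log_deriv_pochhammer:
  assumes "\<rho> > 0" "\<beta> > 0" "c \<ge> 0"
  shows "nonneg_log_deriv (Abs_fps (\<lambda>n. (- c) ^ n / fact n * pochhammer (real n * \<rho> + \<beta>) k))"
proof (induction k)
  case 0
  have "nonneg_log_deriv (fps_exp (- c))"
    using assms
    by (intro nonneg_log_derivI[where S = "fps_const c * fps_X"])
       (auto intro!: nonneg_fps_mult nonneg_fps_const nonneg_fps_X simp: algebra_simps
             simp flip: fps_const_neg)
  then show ?case
    by (simp add: fps_exp_def)
next
  case (Suc k)
  let ?F = "\<lambda>k. Abs_fps (\<lambda>n. (- c) ^ n / fact n * pochhammer (real n * \<rho> + \<beta>) k)"
  have "?F (Suc k) = fps_const (\<beta> + real k) * ?F k + fps_const \<rho> * (fps_X * fps_deriv (?F k))"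
  proof (rule fps_ext)
    fix n
    show "fps_nth (?F (Suc k)) n =
        fps_nth (fps_const (\<beta> + real k) * ?F k + fps_const \<rho> * (fps_X * fps_deriv (?F k))) n"
      by (cases n) (simp_all add: pochhammer_Suc algebra_simps add_divide_distrib del: of_nat_Suc power_Suc fact_Suc)
  qed
  then show ?case
    using nonneg_log_deriv_euler[OF Suc, of "\<beta> + real k" \<rho>] assms by simp
qed

definition wright_fps :: "real \<Rightarrow> real \<Rightarrow> real fps" where
  "wright_fps \<rho> \<beta> = Abs_fps (\<lambda>n. (- 1) ^ n / (fact n * Gamma (real n * \<rho> + \<beta>)))"

lemma nonneg_log_deriv_cmult:
  assumes "nonneg_log_deriv l" "c > 0"
  shows "nonneg_log_deriv (fps_const c * l)"
  using nonneg_log_deriv_euler[OF assms, of 0] by simp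

lemma nonneg_log_deriv_wright_fps:
  assumes "\<rho> > 0" "\<beta> > 0"
  shows "nonneg_log_deriv (wright_fps \<rho> \<beta>)"
proof (rule nonneg_log_deriv_limit)
  \<comment> \<open>In Gauss's product \<open>1 / \<Gamma>(x)\<close> is the limit of
    \<open>x (x + 1) ... (x + k) / (k! k powr x)\<close>. At \<open>x = n \<rho> + \<beta>\<close>
    the power of \<open>k\<close> splits into a constant factor, with exponent
    \<open>- \<beta>\<close>, and the \<open>n\<close>-th power of
    \<open>c = k powr (- \<rho>)\<close>.\<close>
  define F where "F k = fps_const (1 / (fact k * exp (\<beta> * ln (real k)))) *
    Abs_fps (\<lambda>n. (- exp (- \<rho> * ln (real k))) ^ n / fact n *
      pochhammer (real n * \<rho> + \<beta>) (k + 1))" for k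
  show "nonneg_log_deriv (F k)" for k
    unfolding F_def using assms
    by (intro nonneg_log_deriv_cmult nonneg_log_deriv_pochhammer) auto
  have "fps_nth (F k) n = (- 1) ^ n / fact n * rGamma_series (real n * \<rho> + \<beta>) k" for k n
  proof -
    have "(- exp (- \<rho> * ln (real k))) ^ n = (- 1) ^ n * exp (- (real n * \<rho> * ln (real k)))"
      by (subst power_minus) (simp add: exp_of_nat_mult[symmetric] mult_ac)
    then show ?thesis
      by (simp add: F_def rGamma_series_def exp_add ring_distribs exp_minus field_simps)
  qed
  moreover have "(\<lambda>k. (- 1) ^ n / fact n * rGamma_series (real n * \<rho> + \<beta>) k) \<longlonglongrightarrow>
      fps_nth (wright_fps \<rho> \<beta>) n" for n
    by (auto intro!: tendsto_eq_intros simp: wright_fps_def rGamma_inverse_Gamma field_simps)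
  ultimately show "(\<lambda>k. fps_nth (F k) n) \<longlonglongrightarrow> fps_nth (wright_fps \<rho> \<beta>) n" for n
    by simp
  show "fps_nth (wright_fps \<rho> \<beta>) 0 > 0"
    using assms by (simp add: wright_fps_def Gamma_real_pos)
qed

text \<open>Since \<open>\<rho> > 0\<close>, the argument of Gamma eventually exceeds 2, where Gamma
  is at least 1; from there on the exponential series dominates.\<close>

lemma fps_conv_radius_wright_fps:
  assumes "\<rho> > 0"
  shows "fps_conv_radius (wright_fps \<rho> \<beta>) = \<infinity>"
  unfolding fps_conv_radius_def
proof (rule conv_radius_inftyI'')
  fix z :: real
  have "filterlim (\<lambda>n. \<beta> + real n * \<rho>) at_top sequentially"
    using assms
    by (intro filterlim_tendsto_add_at_top filterlim_at_top_mult_tendsto_pos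
        filterlim_real_sequentially tendsto_const) auto
  then have "\<forall>\<^sub>F n in sequentially. \<beta> + real n * \<rho> > 2"
    by (rule filterlim_at_top_dense[THEN iffD1, rule_format])
  then have "\<forall>\<^sub>F n in sequentially. norm (fps_nth (wright_fps \<rho> \<beta>) n * z ^ n) \<le> norm z ^ n /\<^sub>R fact n"
  proof eventually_elim
    case (elim n)
    have "Gamma (2 :: real) = 1"
      using Gamma_fact[of 1, where ?'a = real] by simp
    then have "Gamma (real n * \<rho> + \<beta>) \<ge> 1"
      using Gamma_real_strict_mono[of 2 "real n * \<rho> + \<beta>"] elim by simp
    then have "norm z ^ n * 1 \<le> norm z ^ n * Gamma (real n * \<rho> + \<beta>)"
      by (intro mult_left_mono) auto
    then show ?case
      using \<open>Gamma (real n * \<rho> + \<beta>) \<ge> 1\<close>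
      by (simp add: wright_fps_def abs_mult power_abs field_simps)
  qed
  moreover have "summable (\<lambda>n. norm z ^ n /\<^sub>R fact n)"
    by (rule summable_exp_generic)
  ultimately show "summable (\<lambda>n. fps_nth (wright_fps \<rho> \<beta>) n * z ^ n)"
    by (rule summable_comparison_test_ev)
qed

subsection \<open>Evaluation of real power series at complex points\<close>

lemma fps_conv_radius_mono:
  fixes f :: "'a :: {banach, real_normed_div_algebra} fps" and g :: "'b :: {banach, real_normed_div_algebra} fps"
  assumes "\<And>n. norm (fps_nth f n) \<le> norm (fps_nth g n)"
  shows "fps_conv_radius g \<le> fps_conv_radius f"
  unfolding fps_conv_radius_def
proof (rule conv_radius_geI_ex')
  fix r :: real assume r: "0 < r" "ereal r < conv_radius (fps_nth g)"
  have "summable (\<lambda>n. norm (fps_nth g n * of_real r ^ n))"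
    by (rule abs_summable_in_conv_radius) (use r in simp)
  then show "summable (\<lambda>n. fps_nth f n * of_real r ^ n)"
    by (rule summable_comparison_test'[where N = 0])
       (use assms r in \<open>simp add: norm_mult norm_power mult_right_mono\<close>)
qed

text \<open>Signs of coefficients are handled over the reals and holomorphy over the complex
  numbers; this embedding passes from one to the other.\<close>

definition complex_fps :: "real fps \<Rightarrow> complex fps" where
  "complex_fps S = Abs_fps (\<lambda>n. of_real (fps_nth S n))"

lemma complex_fps_nth [simp]: "fps_nth (complex_fps S) n = of_real (fps_nth S n)"
  by (simp add: complex_fps_def)

lemma complex_fps_simps:
  "complex_fps (S + T) = complex_fps S + complex_fps T"
  "complex_fps (S - T) = complex_fps S - complex_fps T"
  "complex_fps (- S) = - complex_fps S"
  "complex_fps (S * T) = complex_fps S * complex_fps T"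
  "complex_fps (fps_const c) = fps_const (of_real c)"
  "complex_fps fps_X = fps_X"
  "complex_fps 1 = 1"
  "complex_fps (fps_deriv S) = fps_deriv (complex_fps S)"
  by (simp_all add: fps_eq_iff fps_mult_nth fps_X_def)

lemma fps_conv_radius_complex_fps [simp]: "fps_conv_radius (complex_fps S) = fps_conv_radius S"
  by (intro antisym fps_conv_radius_mono) simp_all

lemma eval_complex_fps_of_real:
  assumes "norm x < fps_conv_radius S"
  shows "eval_fps (complex_fps S) (of_real x) = of_real (eval_fps S x)"
  using sums_unique[OF sums_of_real[OF sums_eval_fps[OF assms], where ?'a = complex]]
  by (simp add: eval_fps_def)

lemma norm_eval_complex_fps_le:
  assumes "nonneg_fps S" "norm z < fps_conv_radius S"
  shows "norm (eval_fps (complex_fps S) z) \<le> eval_fps S (norm z)"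
proof -
  have "norm (fps_nth (complex_fps S) n * z ^ n) = fps_nth S n * norm z ^ n" for n
    using assms by (simp add: norm_mult norm_power nonneg_fps_def)
  then show ?thesis
    using summable_norm[OF norm_summable_fps[of z "complex_fps S"]] assms
    by (simp add: eval_fps_def)
qed

text \<open>All terms of the difference are nonnegative, so a single one is a lower bound. This
  yields both the strict monotonicity and the growth of \<open>A\<close> below.\<close>

lemma eval_fps_diff_ge:
  fixes S :: "real fps"
  assumes "nonneg_fps S" "0 \<le> x" "x \<le> y" "ereal y < fps_conv_radius S"
  shows "fps_nth S k * (y ^ k - x ^ k) \<le> eval_fps S y - eval_fps S x"
proof -
  have r: "ereal (norm x) < fps_conv_radius S" "ereal (norm y) < fps_conv_radius S"
    using assms by (auto intro: le_less_trans[of _ "ereal y"])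
  have s: "(\<lambda>n. fps_nth S n * (y ^ n - x ^ n)) sums (eval_fps S y - eval_fps S x)"
    unfolding right_diff_distrib using r by (intro sums_diff sums_eval_fps)
  have "(\<Sum>n\<in>{k}. fps_nth S n * (y ^ n - x ^ n)) \<le> (\<Sum>n. fps_nth S n * (y ^ n - x ^ n))"
    using assms s by (intro sum_le_suminf sums_summable[OF s] mult_nonneg_nonneg)
      (auto simp: nonneg_fps_def power_mono)
  then show ?thesis
    using sums_unique[OF s] by simp
qed

text \<open>The formal equation \<open>y' = - P' y\<close> makes the derivative of
  \<open>y exp P\<close> vanish, and the constant is read off at 0.\<close>

lemma eval_fps_eq_exp:
  fixes y P :: "complex fps"
  assumes "fps_deriv y = - (fps_deriv P * y)" "fps_nth P 0 = 0"
    and z: "norm z < fps_conv_radius y" "norm z < fps_conv_radius P"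
  shows "eval_fps y z = fps_nth y 0 * exp (- eval_fps P z)"
proof -
  \<comment> \<open>This disc is convex, contains both 0 and \<open>z\<close>, and lies inside both
    discs of convergence.\<close>
  define s where "s = cball (0::complex) (norm z)"
  have "((\<lambda>w. eval_fps y w * exp (eval_fps P w)) has_field_derivative 0) (at w within s)"
    if "w \<in> s" for w
  proof -
    have w: "norm w < fps_conv_radius y" "norm w < fps_conv_radius P"
      using that z by (auto simp: s_def intro: le_less_trans[of _ "ereal (norm z)"])
    have "eval_fps (fps_deriv y) w = - (eval_fps (fps_deriv P) w * eval_fps y w)"
      unfolding assms(1) using w fps_conv_radius_deriv[of P] fps_conv_radius_mult[of "fps_deriv P" y]
      by (subst eval_fps_minus eval_fps_mult; simp add: less_le_trans min_def split: if_splits)+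
    then show ?thesis
      using w by (auto intro!: derivative_eq_intros has_field_derivative_eval_fps
          has_field_derivative_at_within[OF DERIV_chain2[OF DERIV_exp]] simp: algebra_simps)
  qed
  then obtain c where c: "\<forall>w\<in>s. eval_fps y w * exp (eval_fps P w) = c"
    using has_field_derivative_zero_constant[of s "\<lambda>w. eval_fps y w * exp (eval_fps P w)"]
    by (auto simp: s_def)
  have "eval_fps y z * exp (eval_fps P z) = eval_fps y 0 * exp (eval_fps P 0)"
    using c by (simp add: s_def)
  then show ?thesis
    using assms(2) by (simp add: eval_fps_at_0 exp_minus field_simps)
qed

text \<open>By continuity the lower bound extends to the closed disc, and compactness leaves a
  margin \<open>d\<close> around it on which \<open>f\<close> is still nonzero.\<close>

lemma nonzero_on_larger_ball:
  fixes f :: "complex \<Rightarrow> complex"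
  assumes "continuous_on UNIV f" "R > 0" "\<delta> > 0" "\<And>z. norm z < R \<Longrightarrow> norm (f z) \<ge> \<delta>"
  obtains R' where "R' > R" "\<And>z. norm z < R' \<Longrightarrow> f z \<noteq> 0"
proof -
  have nz: "f z \<noteq> 0" if "z \<in> cball 0 R" for z
  proof -
    have "continuous_on (closure (ball 0 R)) (\<lambda>z. norm (f z))"
      by (intro continuous_on_norm continuous_on_subset[OF assms(1)] subset_UNIV)
    then have "norm (f z) \<ge> \<delta>"
      by (rule continuous_ge_on_closure) (use that assms in auto)
    with \<open>\<delta> > 0\<close> show ?thesis by auto
  qed
  have "open (f -` (- {0}))"
    using assms(1) by (intro open_vimage) auto
  moreover have "cball 0 R \<subseteq> f -` (- {0})"
    using nz by auto
  ultimately obtain d where d: "d > 0" "(\<Union>x\<in>cball 0 R. ball x d) \<subseteq> f -` (- {0})"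
    by (rule compact_subset_open_imp_ball_epsilon_subset[OF compact_cball])
  have "f z \<noteq> 0" if z: "norm z < R + d" for z
  proof (cases "norm z \<le> R")
    case False
    \<comment> \<open>The radial projection of \<open>z\<close> onto the circle of radius
      \<open>R\<close>; its distance from \<open>z\<close> is \<open>norm z - R < d\<close>.\<close>
    define w where "w = of_real (R / norm z) * z"
    have z0: "z \<noteq> 0"
      using assms False by auto
    then have "norm w = R"
      using assms False by (auto simp: w_def norm_mult norm_divide)
    moreover have "z - w = of_real (1 - R / norm z) * z"
      by (simp add: w_def algebra_simps)
    then have "norm (z - w) = norm z - R"
      using assms False z0 by (simp only: norm_mult norm_of_real) (simp add: abs_if field_simps)
    ultimately have "z \<in> (\<Union>x\<in>cball 0 R. ball x d)"
      using z by (intro UN_I[of w]) (auto simp: dist_norm norm_minus_commute)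
    with d(2) have "z \<in> f -` (- {0})"
      by (rule subsetD)
    then show ?thesis by simp
  qed (use nz in auto)
  then show ?thesis
    using that[of "R + d"] d by auto
qed

subsection \<open>Radius of convexity from the logarithmic derivative\<close>

text \<open>The common setting of the three cases:
  \<open>F = z (e / e(0)) powr (1 / \<gamma>)\<close> near 0, so that
  \<open>T = - X e' / (\<gamma> e)\<close> gives \<open>z F' / F = 1 - T\<close>. The exponent is
  \<open>\<gamma> = \<beta>\<close> for \<open>f\<close> and \<open>\<gamma> = 1\<close> for
  \<open>g\<close> and \<open>h\<close>.\<close>

locale entire_log_deriv =
  fixes e T :: "real fps" and \<gamma> :: real
  assumes e_entire: "fps_conv_radius e = \<infinity>"
    and e_pos: "fps_nth e 0 > 0"
    and \<gamma>_pos: "\<gamma> > 0"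
    and T_nonneg: "nonneg_fps T"
    and T_nonzero: "T \<noteq> 0"
    and T_eq: "fps_X * fps_deriv e = - (fps_const \<gamma> * T * e)"
begin

text \<open>
  In the disc of convergence of \<open>A\<close>, the function \<open>F z = z exp (- L z)\<close> satisfies
  \<open>z F' / F = 1 - T\<close> and \<open>1 + z F'' / F' = 1 - A\<close>.
\<close>
definition A :: "real fps" where
  "A = T + fps_X * fps_deriv T * inverse (1 - T)"

text \<open>The formal integral of \<open>T / X\<close>, so that
  \<open>e = e(0) exp (- \<gamma> L)\<close>. At \<open>n = 0\<close> division by zero gives 0,
  hence \<open>L(0) = 0\<close>.\<close>

definition L :: "real fps" where
  "L = Abs_fps (\<lambda>n. fps_nth T n / real n)"

text \<open>The formal integral of \<open>(A - T) / X = T' / (1 - T)\<close>, that is,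
  \<open>- log (1 - T)\<close>.\<close>

definition M :: "real fps" where
  "M = Abs_fps (\<lambda>n. fps_nth (A - T) n / real n)"

abbreviation R :: ereal where
  "R \<equiv> fps_conv_radius A"

definition F :: "complex \<Rightarrow> complex" where
  "F z = z * exp (- eval_fps (complex_fps L) z)"

lemma T_0: "fps_nth T 0 = 0"
  using arg_cong[OF T_eq, of "\<lambda>f. fps_nth f 0"] e_pos \<gamma>_pos by simp

lemma A_T_nonneg: "nonneg_fps (A - T)"
proof -
  have "nonneg_fps (inverse (1 - T))"
    using nonneg_fps_inverse_const_minus[of 1 T] T_nonneg T_0 by simp
  then show ?thesis
    unfolding A_def using T_nonneg
    by (simp add: nonneg_fps_mult nonneg_fps_deriv nonneg_fps_X)
qed

lemma A_nonneg: "nonneg_fps A"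
  using nonneg_fps_add[OF A_T_nonneg T_nonneg] by simp

lemma A_0: "fps_nth A 0 = 0"
  by (simp add: A_def T_0 mult.assoc)

lemma L_0: "fps_nth L 0 = 0" and M_0: "fps_nth M 0 = 0"
  by (simp_all add: L_def M_def)

lemma T_le_A: "fps_nth T n \<le> fps_nth A n"
  using A_T_nonneg by (simp add: nonneg_fps_def)

text \<open>Division by \<open>n \<ge> 1\<close> only shrinks coefficients. Together with the bounds
  for \<open>T\<close> and \<open>M\<close> this makes the disc of convergence of \<open>A\<close> a
  common domain for all four series.\<close>

lemma L_le_A: "norm (fps_nth L n) \<le> norm (fps_nth A n)"
proof (cases "n = 0")
  case False
  then have "fps_nth T n / real n \<le> fps_nth T n / 1"
    using T_nonneg by (intro divide_left_mono) (auto simp: nonneg_fps_def)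
  then show ?thesis
    using T_le_A[of n] T_nonneg A_nonneg by (simp add: L_def nonneg_fps_def)
qed (simp add: L_def)

lemma M_le_A: "norm (fps_nth M n) \<le> norm (fps_nth A n)"
proof (cases "n = 0")
  case False
  then have "fps_nth (A - T) n / real n \<le> fps_nth (A - T) n / 1"
    using A_T_nonneg by (intro divide_left_mono) (auto simp: nonneg_fps_def)
  moreover have "fps_nth (A - T) n \<le> fps_nth A n"
    using T_nonneg by (simp add: nonneg_fps_def)
  moreover have "fps_nth M n \<ge> 0" "fps_nth A n \<ge> 0"
    using A_T_nonneg A_nonneg by (simp_all add: M_def nonneg_fps_def)
  ultimately show ?thesis
    by (simp add: M_def)
qed (simp add: M_def)

lemma radius_T: "R \<le> fps_conv_radius T"
  using T_nonneg A_nonneg T_le_A by (intro fps_conv_radius_mono) (simp add: nonneg_fps_def)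

lemma radius_L: "R \<le> fps_conv_radius L"
  using L_le_A by (intro fps_conv_radius_mono)

lemma radius_M: "R \<le> fps_conv_radius M"
  using M_le_A by (intro fps_conv_radius_mono)

lemma in_radius:
  assumes "ereal r < R"
  shows "ereal r < fps_conv_radius T" "ereal r < fps_conv_radius L" "ereal r < fps_conv_radius M"
  using assms radius_T radius_L radius_M by (auto intro: less_le_trans)

lemma in_radius_deriv:
  assumes "ereal r < R"
  shows "ereal r < fps_conv_radius (fps_deriv L)" "ereal r < fps_conv_radius (fps_deriv M)"
  using in_radius[OF assms] fps_conv_radius_deriv[of L] fps_conv_radius_deriv[of M]
  by (auto intro: less_le_trans)

lemma X_deriv_L: "fps_X * fps_deriv L = T"
proof (rule fps_ext)
  fix n show "fps_nth (fps_X * fps_deriv L) n = fps_nth T n"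
    using T_0 by (cases n) (simp_all add: L_def)
qed

lemma X_deriv_M: "fps_X * fps_deriv M = A - T"
proof (rule fps_ext)
  fix n show "fps_nth (fps_X * fps_deriv M) n = fps_nth (A - T) n"
    using T_0 A_0 by (cases n) (simp_all add: M_def)
qed

lemma A_T_mult: "(A - T) * (1 - T) = fps_X * fps_deriv T"
  using inverse_mult_eq_1[of "1 - T"] T_0 by (simp add: A_def mult.assoc)

section \<open>Exponential representations of \<open>e\<close> and \<open>1 - T\<close>\<close>

lemma deriv_e: "fps_deriv e = - (fps_deriv (fps_const \<gamma> * L) * e)"
proof -
  have "fps_X * fps_deriv e = fps_X * - (fps_deriv (fps_const \<gamma> * L) * e)"
  proof -
    have "fps_X * fps_deriv e = - (fps_const \<gamma> * (fps_X * fps_deriv L) * e)"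
      by (simp only: T_eq X_deriv_L)
    then show ?thesis
      by (simp add: algebra_simps)
  qed
  then show ?thesis
    by (simp only: mult_cancel_left) simp
qed

lemma deriv_1_T: "fps_deriv (1 - T) = - (fps_deriv M * (1 - T))"
proof -
  have "fps_X * fps_deriv (1 - T) = - ((A - T) * (1 - T))"
    unfolding A_T_mult by (simp add: algebra_simps)
  also have "\<dots> = fps_X * - (fps_deriv M * (1 - T))"
    unfolding X_deriv_M[symmetric] by (simp add: algebra_simps)
  finally show ?thesis
    by (simp only: mult_cancel_left) simp
qed

text \<open>Besides identifying \<open>F\<close>, this shows that \<open>e\<close> has no zero in
  the disc of convergence of \<open>A\<close>.\<close>

lemma e_eq_exp:
  assumes z: "ereal (norm z) < R"
  shows "eval_fps (complex_fps e) z =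
           of_real (fps_nth e 0) * exp (- (of_real \<gamma> * eval_fps (complex_fps L) z))"
proof -
  define K where "K = fps_const \<gamma> * L"
  have "fps_deriv (complex_fps e) = - (fps_deriv (complex_fps K) * complex_fps e)"
    using arg_cong[OF deriv_e, of complex_fps] by (simp only: K_def[symmetric] complex_fps_simps)
  then have "eval_fps (complex_fps e) z = fps_nth (complex_fps e) 0 * exp (- eval_fps (complex_fps K) z)"
    using in_radius[OF z] \<gamma>_pos e_entire
    by (intro eval_fps_eq_exp) (simp_all add: K_def fps_conv_radius_cmult_left L_0)
  also have "eval_fps (complex_fps K) z = of_real \<gamma> * eval_fps (complex_fps L) z"
    using in_radius[OF z] by (simp add: K_def complex_fps_simps eval_fps_mult)
  finally show ?thesis by simp
qed

lemma one_minus_T_eq_exp: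
  assumes z: "ereal (norm z) < R"
  shows "1 - eval_fps (complex_fps T) z = exp (- eval_fps (complex_fps M) z)"
proof -
  define u where "u = 1 - T"
  have "fps_deriv (complex_fps u) = - (fps_deriv (complex_fps M) * complex_fps u)"
    using arg_cong[OF deriv_1_T, of complex_fps] by (simp only: u_def[symmetric] complex_fps_simps)
  moreover have "ereal (norm z) < fps_conv_radius u"
    using in_radius[OF z] less_le_trans[OF _ fps_conv_radius_diff[of 1 T], of "ereal (norm z)"]
    by (simp add: u_def)
  ultimately have "eval_fps (complex_fps u) z = fps_nth (complex_fps u) 0 *
          exp (- eval_fps (complex_fps M) z)"
    using in_radius[OF z] by (intro eval_fps_eq_exp) (simp_all add: M_0)
  then have "eval_fps (complex_fps (1 - T)) z = exp (- eval_fps (complex_fps M) z)"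
    by (simp add: u_def T_0)
  then show ?thesis
    using in_radius[OF z] by (simp add: complex_fps_simps eval_fps_diff)
qed

section \<open>Derivatives of \<open>F\<close> in the disc of convergence of
  \<open>A\<close>\<close>

lemma z_deriv_L:
  assumes z: "ereal (norm z) < R"
  shows "z * eval_fps (fps_deriv (complex_fps L)) z = eval_fps (complex_fps T) z"
proof -
  have "eval_fps (complex_fps T) z = eval_fps (fps_X * fps_deriv (complex_fps L)) z"
    using arg_cong[OF X_deriv_L, of complex_fps] by (simp only: complex_fps_simps)
  then show ?thesis
    using in_radius_deriv[OF z] by (simp add: eval_fps_mult complex_fps_simps(8)[symmetric])
qed

lemma z_deriv_M:
  assumes z: "ereal (norm z) < R"
  shows "z * eval_fps (fps_deriv (complex_fps M)) z =
    eval_fps (complex_fps A) z - eval_fps (complex_fps T) z"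
proof -
  have "eval_fps (complex_fps (A - T)) z = eval_fps (fps_X * fps_deriv (complex_fps M)) z"
    unfolding X_deriv_M[symmetric] complex_fps_simps ..
  also have "\<dots> = z * eval_fps (fps_deriv (complex_fps M)) z"
    using in_radius_deriv[OF z] by (simp add: eval_fps_mult complex_fps_simps(8)[symmetric])
  finally show ?thesis
    using z in_radius[OF z] by (simp add: complex_fps_simps eval_fps_diff)
qed

text \<open>The product rule gives \<open>exp (- L) (1 - T)\<close>, and
  \<open>1 - T = exp (- M)\<close>. In this form the derivative visibly never vanishes.\<close>

lemma F_deriv:
  assumes z: "ereal (norm z) < R"
  shows "(F has_field_derivative
    exp (- eval_fps (complex_fps L) z - eval_fps (complex_fps M) z)) (at z)"
proof -
  have "(F has_field_derivative exp (- eval_fps (complex_fps L) z) *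
      (1 - z * eval_fps (fps_deriv (complex_fps L)) z)) (at z)"
    unfolding F_def[abs_def] using in_radius[OF z]
    by (auto intro!: derivative_eq_intros has_field_derivative_eval_fps simp: algebra_simps)
  then show ?thesis
    by (simp add: z_deriv_L[OF z] one_minus_T_eq_exp[OF z] exp_diff exp_minus field_simps)
qed

lemma deriv_F:
  assumes z: "ereal (norm z) < R"
  shows "deriv F z = exp (- eval_fps (complex_fps L) z - eval_fps (complex_fps M) z)"
  using F_deriv[OF z] by (rule DERIV_imp_deriv)

text \<open>The logarithmic derivative of \<open>exp (- L - M)\<close> is \<open>- L' - M'\<close>;
  multiplied by \<open>z\<close> it becomes \<open>- T - (A - T) = - A\<close>.\<close>

lemma deriv2_F:
  assumes z: "ereal (norm z) < R"
  shows "1 + z * deriv (deriv F) z / deriv F z = 1 - eval_fps (complex_fps A) z"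
proof -
  let ?G = "\<lambda>z. exp (- eval_fps (complex_fps L) z - eval_fps (complex_fps M) z)"
  let ?D = "- eval_fps (fps_deriv (complex_fps L)) z - eval_fps (fps_deriv (complex_fps M)) z"
  have "\<forall>\<^sub>F w in nhds z. w \<in> eball 0 R"
    using z by (intro eventually_nhds_in_open) auto
  then have "\<forall>\<^sub>F w in nhds z. deriv F w = ?G w"
    by eventually_elim (simp add: deriv_F)
  then have "deriv (deriv F) z = deriv ?G z"
    by (rule deriv_cong_ev) simp
  also have "\<dots> = ?G z * ?D"
    using in_radius[OF z]
    by (intro DERIV_imp_deriv)
       (auto intro!: derivative_eq_intros has_field_derivative_eval_fps simp: algebra_simps)
  finally have "deriv (deriv F) z / deriv F z = ?D"
    by (simp add: deriv_F[OF z])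
  then have "z * deriv (deriv F) z / deriv F z = z * ?D"
    by (metis times_divide_eq_right)
  also have "\<dots> = - eval_fps (complex_fps A) z"
    using z_deriv_L[OF z] z_deriv_M[OF z] by (simp add: algebra_simps)
  finally show ?thesis by simp
qed

lemma F_holomorphic: "F holomorphic_on eball 0 R"
proof (rule holomorphic_onI)
  fix z :: complex assume "z \<in> eball 0 R"
  then have "F field_differentiable at z"
    using F_deriv[of z] unfolding field_differentiable_def by auto
  then show "F field_differentiable at z within eball 0 R"
    by (rule field_differentiable_at_within)
qed

text \<open>
  With \<open>N = e (\<gamma> e + X e') = \<gamma> e\<^sup>2 (1 - T)\<close>, the product \<open>A N\<close> is entire, so \<open>A\<close> converges in every
  disc without zeros of \<open>N\<close>.
\<close>
definition N :: "real fps" where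
  "N = e * (fps_const \<gamma> * e + fps_X * fps_deriv e)"

lemma N_eq: "N = fps_const \<gamma> * e * e * (1 - T)"
  unfolding N_def T_eq by (simp add: algebra_simps)

lemma entire_simps [simp]:
  "fps_conv_radius (fps_deriv e) = \<infinity>"
  "fps_conv_radius (fps_deriv (fps_deriv e)) = \<infinity>"
  using e_entire fps_conv_radius_deriv[of e] fps_conv_radius_deriv[of "fps_deriv e"] by auto

lemma N_entire: "fps_conv_radius N = \<infinity>"
proof -
  have "fps_conv_radius N \<ge> \<infinity>"
    unfolding N_def using e_entire
    by (intro fps_conv_radius_mult_ge fps_conv_radius_add_ge) simp_all
  then show ?thesis by simp
qed

text \<open>The factor \<open>N\<close> clears all denominators: \<open>\<gamma> T e = - d\<close>
  with \<open>d = X e'\<close> entire. Two factors \<open>e\<close> occur in \<open>N\<close>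
  because \<open>T\<^sup>2\<close> and \<open>X T'\<close> have denominator
  \<open>e\<^sup>2\<close>.\<close>

lemma A_N_entire: "fps_conv_radius (A * N) = \<infinity>"
proof -
  define d where "d = fps_X * fps_deriv e"
  have Te: "fps_const \<gamma> * T * e = - d"
    using T_eq by (simp add: d_def)
  have dd: "fps_const \<gamma> * (fps_X * fps_deriv T) * e = - (fps_X * fps_deriv d) - fps_const \<gamma> * T * d"
  proof -
    have "fps_X * fps_deriv (fps_const \<gamma> * T * e) = fps_X * fps_deriv (- d)"
      by (simp only: Te)
    then show ?thesis
      by (simp add: d_def algebra_simps)
  qed
  have "A * N = fps_const \<gamma> * e * e * (T * (1 - T) + (A - T) * (1 - T))"
    by (simp add: N_eq algebra_simps)
  also have "\<dots> = (fps_const \<gamma> * T * e) * e - T * e * (fps_const \<gamma> * T * e) +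
      (fps_const \<gamma> * (fps_X * fps_deriv T) * e) * e"
    by (simp only: A_T_mult) (simp add: algebra_simps)
  also have "\<dots> = - d * e - T * e * (- d) + (- (fps_X * fps_deriv d) - fps_const \<gamma> * T * d) * e"
    by (simp only: Te dd)
  also have "\<dots> = - d * e + T * e * d - (fps_X * fps_deriv d) * e - (fps_const \<gamma> * T * e) * d"
    by (simp add: algebra_simps)
  also have "T * e = fps_const (inverse \<gamma>) * (fps_const \<gamma> * T * e)"
    using \<gamma>_pos by (simp add: mult.assoc[symmetric])
  also have "\<dots> = - (fps_const (inverse \<gamma>) * d)"
    by (simp add: Te)
  finally have eq: "A * N = - d * e + - (fps_const (inverse \<gamma>) * d) * d - fps_X * fps_deriv d * e + d * d"
    by (simp add: Te)
  have d: "fps_conv_radius d \<ge> \<infinity>"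
    unfolding d_def by (intro fps_conv_radius_mult_ge) simp_all
  moreover have "fps_conv_radius (fps_deriv d) \<ge> \<infinity>"
    using d fps_conv_radius_deriv[of d] by simp
  ultimately have "fps_conv_radius (A * N) \<ge> \<infinity>"
    unfolding eq fps_conv_radius_uminus using e_entire \<gamma>_pos
    by (intro fps_conv_radius_add_ge fps_conv_radius_diff_ge fps_conv_radius_mult_ge)
       (simp_all add: fps_conv_radius_cmult_left)
  then show ?thesis by simp
qed

lemma N_0: "fps_nth N 0 > 0"
  using e_pos \<gamma>_pos T_0 by (simp add: N_eq)

text \<open>\<open>A\<close> is the quotient of the entire series \<open>A N\<close> and
  \<open>N\<close>, and \<open>N(0) > 0\<close>.\<close>

lemma radius_pos: "R > 0"
proof -
  have "fps_conv_radius (inverse N) > 0"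
    using N_0 N_entire by (intro fps_conv_radius_inverse_pos) auto
  moreover have "A * N * inverse N = A"
    using inverse_mult_eq_1'[of N] N_0 by (simp add: mult.assoc)
  then have "R = fps_conv_radius (A * N * inverse N)"
    by (simp only:)
  then have "R \<ge> min \<infinity> (fps_conv_radius (inverse N))"
    using fps_conv_radius_mult[of "A * N" "inverse N"] unfolding A_N_entire by (simp only:)
  ultimately show ?thesis by simp
qed

section \<open>Monotonicity of \<open>A\<close> and existence of the root\<close>

lemma A_coeff_pos: obtains k where "k \<ge> 1" "fps_nth A k > 0"
proof -
  obtain k where k: "fps_nth T k \<noteq> 0"
    using T_nonzero by (auto simp: fps_eq_iff)
  then have "k \<ge> 1" "fps_nth A k > 0"
    using T_0 T_nonneg T_le_A[of k] by (cases k; force simp: nonneg_fps_def order.order_iff_strict)+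
  then show ?thesis by (rule that)
qed

lemma A_strict_mono:
  assumes "0 \<le> x" "x < y" "ereal y < R"
  shows "eval_fps A x < eval_fps A y"
proof -
  obtain k where k: "k \<ge> 1" "fps_nth A k > 0"
    by (rule A_coeff_pos)
  then have "0 < fps_nth A k * (y ^ k - x ^ k)"
    using assms by (simp add: power_strict_mono)
  also have "\<dots> \<le> eval_fps A y - eval_fps A x"
    using assms by (intro eval_fps_diff_ge A_nonneg) auto
  finally show ?thesis by simp
qed

text \<open>Both \<open>L\<close> and \<open>M\<close> are bounded by
  \<open>A(norm z) \<le> 1\<close> in modulus, so their exponentials bound \<open>e\<close> and
  \<open>1 - T\<close> from below. The bound is the same for all such \<open>z\<close>, which lets
  it pass to the boundary of the disc.\<close>

lemma N_norm_ge:
  assumes z: "ereal (norm z) < R" and A: "eval_fps A (norm z) \<le> 1"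
  shows "norm (eval_fps (complex_fps N) z) \<ge> \<gamma> * (fps_nth e 0 * exp (- \<gamma>))\<^sup>2 * exp (- 1)"
proof -
  have "norm (eval_fps (complex_fps S) z) \<le> 1" if S: "S = L \<or> S = M" for S
  proof -
    have "nonneg_fps S"
      using S T_nonneg A_T_nonneg by (auto simp: nonneg_fps_def L_def M_def)
    then have "norm (eval_fps (complex_fps S) z) \<le> eval_fps S (norm z)"
      using S in_radius[OF z] by (intro norm_eval_complex_fps_le) auto
    also have "\<dots> \<le> eval_fps A (norm z)"
      unfolding eval_fps_def using S in_radius[OF z] z L_le_A M_le_A A_nonneg
      by (intro suminf_le summable_fps mult_right_mono)
         (auto simp: nonneg_fps_def intro: order_trans[OF abs_ge_self])
    finally show ?thesis using A by simp
  qed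
  then have Re: "Re (eval_fps (complex_fps L) z) \<le> 1" "Re (eval_fps (complex_fps M) z) \<le> 1"
    by (auto intro: order_trans[OF complex_Re_le_cmod])
  have E: "norm (eval_fps (complex_fps e) z) \<ge> fps_nth e 0 * exp (- \<gamma>)"
    using Re e_pos \<gamma>_pos by (simp add: e_eq_exp[OF z] norm_mult norm_exp_eq_Re)
  have T: "norm (1 - eval_fps (complex_fps T) z) \<ge> exp (- 1)"
    using Re by (simp add: one_minus_T_eq_exp[OF z] norm_exp_eq_Re)
  have r: "ereal (norm z) < fps_conv_radius (1 - T)"
    using in_radius[OF z] less_le_trans[OF _ fps_conv_radius_diff[of 1 T], of "ereal (norm z)"]
    by simp
  have ee: "fps_conv_radius (complex_fps e * complex_fps e) = \<infinity>"
    using fps_conv_radius_mult[of "complex_fps e" "complex_fps e"] e_entire by simp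
  have "eval_fps (complex_fps N) z = of_real \<gamma> * (eval_fps (complex_fps e) z)\<^sup>2 *
      (1 - eval_fps (complex_fps T) z)"
  proof -
    have "N = (fps_const \<gamma> * (e * e)) * (1 - T)"
      by (simp add: N_eq mult_ac)
    then have "eval_fps (complex_fps N) z =
      eval_fps (fps_const (of_real \<gamma>) * (complex_fps e * complex_fps e)) z * eval_fps (complex_fps (1 - T)) z"
      using ee r \<gamma>_pos
      by (simp add: complex_fps_simps(4,5) eval_fps_mult fps_conv_radius_cmult_left)
    then show ?thesis
      using ee e_entire in_radius[OF z]
      by (simp add: eval_fps_mult complex_fps_simps eval_fps_diff power2_eq_square)
  qed
  then show ?thesis
    using E T e_pos \<gamma>_pos
    by (simp only: norm_mult norm_power norm_of_real) (intro mult_mono power_mono; simp)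
qed

lemma A_reaches:
  assumes "c \<le> 1"
  shows "\<exists>x\<ge>0. ereal x < R \<and> eval_fps A x \<ge> c"
proof (rule ccontr)
  assume "\<not> ?thesis"
  then have less: "eval_fps A x < c" if "x \<ge> 0" "ereal x < R" for x
    using that by force
  show False
  proof (cases "R = \<infinity>")
    case True
    obtain k where k: "k \<ge> 1" "fps_nth A k > 0"
      by (rule A_coeff_pos)
    \<comment> \<open>Chosen so that the single term \<open>a x ^ k\<close>, with \<open>a\<close>
      the positive coefficient at \<open>k\<close>, is at least \<open>a x \<ge> c\<close>; the
      first inequality uses \<open>x \<ge> 1\<close>.\<close>
    define x where "x = max 1 (c / fps_nth A k)"
    then have x: "x \<ge> 1"
      by simp
    have "c \<le> fps_nth A k * x"
      using k by (simp add: x_def field_simps max_def)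
    also have "\<dots> \<le> fps_nth A k * x ^ k"
      using k x by (intro mult_left_mono self_le_power) auto
    also have "\<dots> \<le> eval_fps A x"
      using eval_fps_diff_ge[OF A_nonneg, of 0 x k] True k x
      by (simp add: eval_fps_at_0 A_0 power_0_left)
    finally show False
      using less[of x] True x by simp
  next
    case False
    then obtain r where r: "R = ereal r" "r > 0"
      using radius_pos by (cases R) auto
    have "continuous_on UNIV (eval_fps (complex_fps N))"
      using N_entire by (intro continuous_on_eval_fps') auto
    moreover have "norm (eval_fps (complex_fps N) z) \<ge> \<gamma> * (fps_nth e 0 * exp (- \<gamma>))\<^sup>2 * exp (- 1)"
      if "norm z < r" for z
      using that r less[of "norm z"] assms by (intro N_norm_ge) auto
    moreover have "\<gamma> * (fps_nth e 0 * exp (- \<gamma>))\<^sup>2 * exp (- 1) > 0"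
      using \<gamma>_pos e_pos by simp
    ultimately obtain r' where r': "r' > r" "\<And>z. norm z < r' \<Longrightarrow> eval_fps (complex_fps N) z \<noteq> 0"
      using nonzero_on_larger_ball r(2) by metis
    \<comment> \<open>As \<open>N\<close> has no zero in the disc of radius \<open>r' > r\<close>,
      the quotient \<open>A = A N / N\<close> converges there, against the choice of
      \<open>r\<close> as its radius of convergence.\<close>
    have "fps_conv_radius (complex_fps (A * N) / complex_fps N) \<ge>
        Min {ereal r', fps_conv_radius (complex_fps (A * N)), fps_conv_radius (complex_fps N)}"
      using r r' A_N_entire N_entire by (intro fps_conv_radius_divide') auto
    also have "complex_fps (A * N) / complex_fps N = complex_fps A"
    proof -
      have "complex_fps N \<noteq> 0"
        using N_0 by (auto simp: fps_eq_iff intro!: exI[of _ 0])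
      then show ?thesis
        by (simp add: complex_fps_simps)
    qed
    finally show False
      using r r' A_N_entire N_entire by simp
  qed
qed

lemma A_root:
  assumes "0 < c" "c \<le> 1"
  obtains r where "r > 0" "ereal r < R" "eval_fps A r = c" "\<And>s. 0 < s \<Longrightarrow> s < r \<Longrightarrow> eval_fps A s < c"
proof -
  obtain x where x: "x \<ge> 0" "ereal x < R" "eval_fps A x \<ge> c"
    using A_reaches[OF assms(2)] by auto
  have below: "ereal t < R" if "t \<le> x" for t
    using that x(2) by (meson ereal_less_eq(3) le_less_trans)
  then have "continuous_on {0..x} (eval_fps A)"
    by (intro continuous_on_eval_fps') auto
  then obtain r where r: "0 \<le> r" "r \<le> x" "eval_fps A r = c"
    using IVT'[of "eval_fps A" 0 c x] x assms by (auto simp: eval_fps_at_0 A_0)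
  have R: "ereal r < R"
    using below r by simp
  have "r \<noteq> 0"
    using r assms by (auto simp: eval_fps_at_0 A_0)
  then show ?thesis
    using that[of r] r R A_strict_mono[of _ r] by auto
qed

text \<open>For \<open>norm z < r\<close> the real part of \<open>A(z)\<close> is at most
  \<open>A(norm z) < A(r) = 1 - \<alpha>\<close>. No larger disc is possible: at the real point
  \<open>r\<close> the expression equals \<alpha> exactly, which violates the strict inequality.
  Only the germ of \<open>f\<close> at 0 enters.\<close>

theorem convexity_radius_eq:
  assumes f: "\<forall>\<^sub>F z in nhds 0. f z = F z"
    and r: "r > 0" "ereal r < R" "eval_fps A r = 1 - \<alpha>"
  shows "convexity_radius \<alpha> f = ereal r"
proof -
  let ?good = "\<lambda>r g. \<exists>G. G holomorphic_on ball 0 r \<and> (\<forall>\<^sub>F z in nhds 0. G z = g z) \<and>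
                       convex_of_order_on \<alpha> (ball 0 r) G"
  have hol: "F holomorphic_on ball 0 s" if "ereal s \<le> R" for s
    using F_holomorphic ball_eball_mono[OF that] by (rule holomorphic_on_subset)
  have good_F: "?good s f \<longleftrightarrow> ?good s F" for s
  proof -
    have "(\<forall>\<^sub>F z in nhds 0. G z = f z) \<longleftrightarrow> (\<forall>\<^sub>F z in nhds 0. G z = F z)" for G
      by (rule eventually_cong[OF f]) simp
    then show ?thesis by simp
  qed
  have convex: "convex_of_order_on \<alpha> (ball 0 r) F"
    unfolding convex_of_order_on_def
  proof (intro ballI conjI)
    fix z :: complex assume "z \<in> ball 0 r"
    then have z: "norm z < r" "ereal (norm z) < R"
      using r by (auto intro: less_trans[of _ "ereal r"])
    show "deriv F z \<noteq> 0"
      by (simp add: deriv_F[OF z(2)])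
    have "Re (eval_fps (complex_fps A) z) \<le> eval_fps A (norm z)"
      using norm_eval_complex_fps_le[OF A_nonneg z(2)] complex_Re_le_cmod order_trans by blast
    also have "\<dots> < 1 - \<alpha>"
      using A_strict_mono[of "norm z" r] z r by simp
    finally show "\<alpha> < Re (1 + z * deriv (deriv F) z / deriv F z)"
      by (simp only: deriv2_F[OF z(2)]) simp
  qed
  have upper: "s \<le> r" if s: "?good s f" for s
  proof (rule ccontr)
    assume "\<not> s \<le> r"
    \<comment> \<open>The comparison with \<open>F\<close> takes place inside its known domain of
      holomorphy, hence in a disc of radius \<open>q\<close> below both \<open>s\<close> and
      \<open>R\<close>.\<close>
    obtain q where q: "r < q" "q < s" "ereal q < R"
    proof (cases R)
      case (real R')
      then show ?thesis
        using that[of "(r + min s R') / 2"] r \<open>\<not> s \<le> r\<close> by (auto simp: min_def field_simps)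
    next
      case PInf
      then show ?thesis
        using that[of "(r + s) / 2"] \<open>\<not> s \<le> r\<close> by auto
    qed (use r in auto)
    obtain G where G: "G holomorphic_on ball 0 s" "\<forall>\<^sub>F z in nhds 0. G z = F z"
        "convex_of_order_on \<alpha> (ball 0 s) G"
      using s unfolding good_F by auto
    have sub: "ball (0::complex) q \<subseteq> ball 0 s"
      using q by auto
    have "?good q F"
      using G sub holomorphic_on_subset[OF G(1) sub]
      by (intro exI[of _ G]) (auto simp: convex_of_order_on_def)
    then have "convex_of_order_on \<alpha> (ball 0 q) F"
      using continuation_convex_iff[of q F \<alpha>] hol[of q] q r by simp
    then have "Re (1 + of_real r * deriv (deriv F) (of_real r) / deriv F (of_real r)) > \<alpha>"
      using q r unfolding convex_of_order_on_def by simp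
    then show False
      using r deriv2_F[of "of_real r"] eval_complex_fps_of_real[of r A] by simp
  qed
  have "?good r f"
    unfolding good_F using continuation_convex_iff[of r F \<alpha>] hol[of r] r convex by simp
  then show ?thesis
    unfolding convexity_radius_def using r(1) upper
    by (intro SUP_eqI) auto
qed

lemma deriv2_F_of_real:
  assumes "0 \<le> r" "ereal r < R"
  shows "deriv F (of_real r) \<noteq> 0"
    "1 + of_real r * deriv (deriv F) (of_real r) / deriv F (of_real r) =
       (of_real \<alpha> :: complex) \<longleftrightarrow> eval_fps A r = 1 - \<alpha>"
proof -
  have r: "ereal (norm (of_real r :: complex)) < R"
    using assms by simp
  show "deriv F (of_real r) \<noteq> 0"
    by (simp add: deriv_F[OF r])
  have "eval_fps (complex_fps A) (of_real r) = of_real (eval_fps A r)"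
    using assms by (intro eval_complex_fps_of_real) simp
  then have "1 + of_real r * deriv (deriv F) (of_real r) / deriv F (of_real r) =
      (of_real (1 - eval_fps A r) :: complex)"
    unfolding deriv2_F[OF r] by simp
  then show "1 + of_real r * deriv (deriv F) (of_real r) / deriv F (of_real r) =
       (of_real \<alpha> :: complex) \<longleftrightarrow> eval_fps A r = 1 - \<alpha>"
    by (simp only: of_real_eq_iff) auto
qed

end

section \<open>The root in terms of the derivatives of the given functions\<close>

context entire_log_deriv
begin

text \<open>The equation involves derivatives of \<open>f\<close> at positive points, so here
  \<open>f\<close> agrees with \<open>F\<close> on the whole disc of convergence of \<open>A\<close>
  and not merely near 0.\<close>

lemma deriv_of_real_root:
  assumes f: "\<And>z. ereal (norm z) < R \<Longrightarrow> f z = F z" and "0 \<le> \<alpha>" "\<alpha> < 1"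
  shows "\<exists>r. convexity_radius \<alpha> f = ereal r \<and>
    smallest_positive (\<lambda>r. deriv f (of_real r) \<noteq> 0 \<and>
      1 + of_real r * deriv (deriv f) (of_real r) / deriv f (of_real r) = of_real \<alpha>) r"
proof -
  obtain r where r: "r > 0" "ereal r < R" "eval_fps A r = 1 - \<alpha>"
    "\<And>s. 0 < s \<Longrightarrow> s < r \<Longrightarrow> eval_fps A s < 1 - \<alpha>"
    using A_root[of "1 - \<alpha>"] assms by auto
  have near: "\<forall>\<^sub>F w in nhds z. w \<in> eball 0 R" if "ereal (norm z) < R" for z :: complex
    using that by (intro eventually_nhds_in_open) auto
  have d1: "deriv f z = deriv F z" if "ereal (norm z) < R" for z
    by (rule deriv_cong_ev) (use near[OF that] f in \<open>auto elim!: eventually_mono\<close>)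
  have d2: "deriv (deriv f) z = deriv (deriv F) z" if "ereal (norm z) < R" for z
    by (rule deriv_cong_ev) (use near[OF that] d1 in \<open>auto elim!: eventually_mono\<close>)
  have "\<forall>\<^sub>F z in nhds 0. f z = F z"
    using near[of 0] radius_pos f by (auto elim!: eventually_mono simp: zero_ereal_def)
  then have "convexity_radius \<alpha> f = ereal r"
    using r by (intro convexity_radius_eq)
  moreover have "smallest_positive (\<lambda>r. deriv f (of_real r) \<noteq> 0 \<and>
      1 + of_real r * deriv (deriv f) (of_real r) / deriv f (of_real r) = of_real \<alpha>) r"
  proof -
    have "ereal s < R" if "s \<le> r" for s
      using that r(2) by (meson ereal_less_eq(3) le_less_trans)
    then have "deriv f (of_real s) = deriv F (of_real s)"
      "deriv (deriv f) (of_real s) = deriv (deriv F) (of_real s)"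
      "deriv F (of_real s) \<noteq> 0"
      "1 + of_real s * deriv (deriv F) (of_real s) / deriv F (of_real s) =
        (of_real \<alpha> :: complex) \<longleftrightarrow> eval_fps A s = 1 - \<alpha>" if "0 < s" "s \<le> r" for s
      using that by (simp_all add: d1 d2 deriv2_F_of_real)
    then show ?thesis
      using r unfolding smallest_positive_def by force
  qed
  ultimately show ?thesis by blast
qed

text \<open>On this interval \<open>P\<close> is \<open>e(0)\<close> times the \<gamma>-th power of
  the value of \<open>F\<close>. With \<open>t = T(x)\<close> one gets
  \<open>x P' / P = \<gamma> (1 - t)\<close> and
  \<open>1 + x P'' / P' = \<gamma> (1 - t) - x t' / (1 - t)\<close>. The weight
  \<open>1 / \<gamma> - 1\<close> turns \<open>\<gamma> (1 - t)\<close> into \<open>1 - t\<close>,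
  which leaves \<open>1 - A(x)\<close>.\<close>

lemma deriv_real_Psi:
  assumes P: "\<And>x. 0 < x \<Longrightarrow> ereal x < R \<Longrightarrow> P x = x powr \<gamma> * eval_fps e x"
    and x: "0 < x" "ereal x < R"
  shows "P x > 0" "deriv P x > 0"
    "1 + x * deriv (deriv P) x / deriv P x + (1 / \<gamma> - 1) * (x * deriv P x / P x) = 1 - eval_fps A x"
proof -
  define l t t' where "l = eval_fps L" and "t = eval_fps T" and "t' = eval_fps (fps_deriv T)"
  define U where "U = {y. 0 < y \<and> ereal y < R}"
  have U: "y > 0" "ereal (norm y) < R" "ereal (norm y) < fps_conv_radius T"
    "ereal (norm y) < fps_conv_radius L" if "y \<in> U" for y
    using that in_radius[of y] by (auto simp: U_def)
  have "U = {0<..} \<inter> ereal -` {..<R}"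
    by (auto simp: U_def)
  moreover have "open (ereal -` {..<R})"
    by (intro open_ereal_vimage) auto
  ultimately have "open U" by auto
  then have near: "\<forall>\<^sub>F w in nhds y. w \<in> U" if "y \<in> U" for y
    using that by (intro eventually_nhds_in_open)
  have xU: "x \<in> U"
    using x by (simp add: U_def)
  have e: "eval_fps e y = fps_nth e 0 * exp (- \<gamma> * l y)" if "y \<in> U" for y
  proof -
    have "of_real (eval_fps e y) = (of_real (fps_nth e 0 * exp (- \<gamma> * l y)) :: complex)"
      using e_eq_exp[of "of_real y"] U[OF that] e_entire
      by (simp add: eval_complex_fps_of_real l_def exp_of_real[symmetric])
    then show ?thesis
      by (simp only: of_real_eq_iff)
  qed
  have t_less: "t y < 1" if "y \<in> U" for y
  proof -
    have "of_real (1 - t y) = (of_real (exp (- eval_fps M y)) :: complex)"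
      using one_minus_T_eq_exp[of "of_real y"] U[OF that] in_radius[of y]
      by (simp add: eval_complex_fps_of_real t_def exp_of_real[symmetric])
    then have "1 - t y = exp (- eval_fps M y)"
      by (simp only: of_real_eq_iff)
    then show ?thesis
      using exp_gt_zero[of "- eval_fps M y"] by linarith
  qed
  have l': "(l has_real_derivative t y / y) (at y)" if "y \<in> U" for y
  proof -
    have "t y = y * eval_fps (fps_deriv L) y"
      using in_radius_deriv[of y] U[OF that] arg_cong[OF X_deriv_L, of "\<lambda>S. eval_fps S y"]
      by (simp add: eval_fps_mult t_def)
    then show ?thesis
      using has_field_derivative_eval_fps[of y L] U[OF that] by (simp add: l_def)
  qed
  have t': "(t has_real_derivative t' y) (at y)" if "y \<in> U" for y
    using has_field_derivative_eval_fps[of y T] U[OF that] by (simp add: t_def t'_def)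
  \<comment> \<open>The explicit form of \<open>P\<close> on the open set \<open>U\<close>;
    derivatives of \<open>P\<close> at points of \<open>U\<close> may be computed from it.\<close>
  define Q where "Q y = y powr \<gamma> * (fps_nth e 0 * exp (- \<gamma> * l y))" for y
  have Q_pos: "Q y > 0" if "y \<in> U" for y
    using U[OF that] e_pos by (simp add: Q_def)
  have Q': "(Q has_real_derivative \<gamma> * Q y * (1 - t y) / y) (at y)" if "y \<in> U" for y
  proof -
    have "y powr (\<gamma> - 1) = y powr \<gamma> / y"
      using U[OF that] by (simp add: powr_diff)
    then show ?thesis
      unfolding Q_def[abs_def] using U[OF that]
      by (auto intro!: derivative_eq_intros l'[OF that] simp: field_simps)
  qed
  have PQ: "P y = Q y" if "y \<in> U" for y
    using P[of y] e[OF that] that by (simp add: Q_def U_def)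
  have dP: "deriv P y = \<gamma> * Q y * (1 - t y) / y" if "y \<in> U" for y
  proof -
    have "deriv P y = deriv Q y"
      by (rule deriv_cong_ev) (use near[OF that] PQ in \<open>auto elim!: eventually_mono\<close>)
    then show ?thesis
      using DERIV_imp_deriv[OF Q'[OF that]] by simp
  qed
  have "deriv (deriv P) x = deriv (\<lambda>y. \<gamma> * Q y * (1 - t y) / y) x"
    by (rule deriv_cong_ev) (use near[OF xU] dP in \<open>auto elim!: eventually_mono\<close>)
  also have "\<dots> = \<gamma> * Q x * (1 - t x) / x * (\<gamma> * (1 - t x) / x - t' x / (1 - t x) - 1 / x)"
    using x t_less[OF xU]
    by (intro DERIV_imp_deriv)
       (auto intro!: derivative_eq_intros Q'[OF xU] t'[OF xU] simp: field_simps)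
  finally have ddP: "deriv (deriv P) x =
    deriv P x * (\<gamma> * (1 - t x) / x - t' x / (1 - t x) - 1 / x)"
    using dP[OF xU] by simp
  show pos: "P x > 0" "deriv P x > 0"
    using Q_pos[OF xU] t_less[OF xU] x \<gamma>_pos by (simp_all add: PQ[OF xU] dP[OF xU])
  have "(eval_fps A x - t x) * (1 - t x) = x * t' x"
  proof -
    have r: "ereal (norm x) < fps_conv_radius (A - T)" "ereal (norm x) < fps_conv_radius (1 - T)"
      "ereal (norm x) < fps_conv_radius (fps_deriv T)"
      using U[OF xU] less_le_trans[OF _ fps_conv_radius_diff[of A T], of "ereal (norm x)"]
        less_le_trans[OF _ fps_conv_radius_diff[of 1 T], of "ereal (norm x)"]
        less_le_trans[OF _ fps_conv_radius_deriv[of T], of "ereal (norm x)"] by simp_all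
    have "eval_fps ((A - T) * (1 - T)) x = eval_fps (fps_X * fps_deriv T) x"
      by (simp only: A_T_mult)
    then show ?thesis
      using r U[OF xU] by (simp add: eval_fps_mult eval_fps_diff t_def t'_def)
  qed
  then have a: "x * t' x / (1 - t x) = eval_fps A x - t x"
    using t_less[OF xU] by (simp add: field_simps)
  have d2: "x * deriv (deriv P) x / deriv P x = \<gamma> * (1 - t x) - x * t' x / (1 - t x) - 1"
  proof -
    have "x * deriv (deriv P) x / deriv P x = x * (\<gamma> * (1 - t x) / x - t' x / (1 - t x) - 1 / x)"
      unfolding ddP using pos by simp
    also have "\<dots> = \<gamma> * (1 - t x) - x * t' x / (1 - t x) - 1"
      using x t_less[OF xU] by (simp add: field_simps)
    finally show ?thesis .
  qed
  have d1: "x * deriv P x / P x = \<gamma> * (1 - t x)"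
    using pos(1) x by (simp add: dP[OF xU] PQ[OF xU])
  show "1 + x * deriv (deriv P) x / deriv P x + (1 / \<gamma> - 1) * (x * deriv P x / P x) =
      1 - eval_fps A x"
    unfolding d1 d2 a using \<gamma>_pos by (simp add: field_simps)
qed

lemma Psi_root:
  assumes f: "\<forall>\<^sub>F z in nhds 0. f z = F z"
    and P: "\<And>x. 0 < x \<Longrightarrow> ereal x < R \<Longrightarrow> P x = x powr \<gamma> * eval_fps e x"
    and "0 \<le> \<alpha>" "\<alpha> < 1"
  shows "\<exists>r. convexity_radius \<alpha> f = ereal r \<and>
    smallest_positive (\<lambda>r. P r \<noteq> 0 \<and> deriv P r \<noteq> 0 \<and>
      1 + r * deriv (deriv P) r / deriv P r + (1 / \<gamma> - 1) * (r * deriv P r / P r) = \<alpha>) r"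
proof -
  obtain r where r: "r > 0" "ereal r < R" "eval_fps A r = 1 - \<alpha>"
    "\<And>s. 0 < s \<Longrightarrow> s < r \<Longrightarrow> eval_fps A s < 1 - \<alpha>"
    using A_root[of "1 - \<alpha>"] assms by auto
  have "ereal s < R" if "s \<le> r" for s
    using that r(2) by (meson ereal_less_eq(3) le_less_trans)
  then have D: "P s > 0" "deriv P s > 0"
    "1 + s * deriv (deriv P) s / deriv P s + (1 / \<gamma> - 1) * (s * deriv P s / P s) = 1 - eval_fps A s"
    if "0 < s" "s \<le> r" for s
    using that deriv_real_Psi[OF P, of s] by auto
  have "smallest_positive (\<lambda>r. P r \<noteq> 0 \<and> deriv P r \<noteq> 0 \<and>
      1 + r * deriv (deriv P) r / deriv P r + (1 / \<gamma> - 1) * (r * deriv P r / P r) = \<alpha>) r"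
    unfolding smallest_positive_def
  proof (intro conjI allI impI)
    fix s assume "0 < s \<and> s < r"
    then show "\<not> (P s \<noteq> 0 \<and> deriv P s \<noteq> 0 \<and>
      1 + s * deriv (deriv P) s / deriv P s + (1 / \<gamma> - 1) * (s * deriv P s / P s) = \<alpha>)"
      using D(3)[of s] r(4)[of s] by auto
  qed (use r D[of r] in auto)
  then show ?thesis
    using convexity_radius_eq[OF f r(1-3)] by blast
qed

text \<open>Near 0 the modulus of \<open>\<gamma> L(z)\<close> is below \<open>pi\<close>, so the
  principal logarithm inverts the exponential in \<open>e / e(0) = exp (- \<gamma> L)\<close> and
  the principal power is the wanted branch.\<close>

lemma F_eq_power:
  "\<forall>\<^sub>F z in nhds 0. z * (eval_fps (complex_fps e) z / of_real (fps_nth e 0)) powr of_real (1 / \<gamma>) = F z"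
proof -
  let ?l = "eval_fps (complex_fps L)"
  have "isCont (\<lambda>z. \<gamma> * norm (?l z)) 0"
    using radius_pos radius_L by (intro continuous_intros) (auto simp: zero_ereal_def)
  then have "((\<lambda>z. \<gamma> * norm (?l z)) \<longlongrightarrow> \<gamma> * norm (?l 0)) (nhds 0)"
    using tendsto_at_iff_tendsto_nhds[of "\<lambda>z. \<gamma> * norm (?l z)" 0] by (simp add: isCont_def)
  then have "\<forall>\<^sub>F z in nhds 0. \<gamma> * norm (?l z) < pi"
    by (rule order_tendstoD) (simp add: eval_fps_at_0 L_0)
  moreover have "\<forall>\<^sub>F z in nhds (0 :: complex). z \<in> eball 0 R"
    using radius_pos by (intro eventually_nhds_in_open) (auto simp: zero_ereal_def)
  ultimately show ?thesis
  proof eventually_elim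
    case (elim z)
    have "eval_fps (complex_fps e) z / of_real (fps_nth e 0) = exp (- (of_real \<gamma> * ?l z))"
      using e_eq_exp[of z] elim e_pos by simp
    moreover have "\<bar>Im (of_real \<gamma> * ?l z)\<bar> < pi"
      using abs_Im_le_cmod[of "of_real \<gamma> * ?l z"] elim \<gamma>_pos by (simp add: norm_mult)
    then have "Ln (exp (- (of_real \<gamma> * ?l z))) = - (of_real \<gamma> * ?l z)"
      by (intro Ln_exp) auto
    ultimately show ?case
      using \<gamma>_pos by (simp add: F_def powr_def)
  qed
qed

lemma F_eq:
  assumes "\<gamma> = 1" "ereal (norm z) < R"
  shows "z * (eval_fps (complex_fps e) z / of_real (fps_nth e 0)) = F z"
  using e_eq_exp[OF assms(2)] e_pos assms(1) by (simp add: F_def)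

end

subsection \<open>The Wright function\<close>

lemma fps_X_square_nth [simp]:
  fixes l :: "real fps"
  shows "fps_nth (l oo fps_X ^ 2) (2 * n) = fps_nth l n"
    and "odd m \<Longrightarrow> fps_nth (l oo fps_X ^ 2) m = 0"
proof -
  have eq: "fps_nth (l oo fps_X ^ 2) k = (\<Sum>i=0..k. if k = 2 * i then fps_nth l i else 0)" for k
    unfolding fps_compose_nth power_mult[symmetric] fps_X_power_nth
    by (intro sum.cong) auto
  show "fps_nth (l oo fps_X ^ 2) (2 * n) = fps_nth l n"
    unfolding eq by (simp add: sum.delta')
  show "fps_nth (l oo fps_X ^ 2) m = 0" if "odd m"
    unfolding eq using that by (intro sum.neutral) auto
qed

text \<open>Substituting the square reindexes the series along the even exponents. As an equivalence
  for every sum \<open>s\<close>, it carries over to \<open>suminf\<close> without any hypothesis on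
  convergence.\<close>

lemma sums_compose_square:
  fixes l :: "real fps" and z :: "'a :: real_normed_field"
  shows "(\<lambda>n. of_real (fps_nth (l oo fps_X ^ 2) n) * z ^ n) sums s \<longleftrightarrow>
    (\<lambda>n. of_real (fps_nth l n) * (z\<^sup>2) ^ n) sums s"
proof -
  have "fps_nth (l oo fps_X ^ 2) n = 0" if "n \<notin> range (\<lambda>n. 2 * n)" for n
    using that by (intro fps_X_square_nth(2)) (auto elim!: evenE)
  then show ?thesis
    using sums_mono_reindex[of "\<lambda>n. 2 * n" "\<lambda>n. of_real (fps_nth (l oo fps_X ^ 2) n) * z ^ n" s]
    by (simp add: strict_mono_def power_mult)
qed

lemma eval_fps_compose_square:
  "eval_fps (l oo fps_X ^ 2) x = eval_fps l (x\<^sup>2)"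
  "eval_fps (complex_fps (l oo fps_X ^ 2)) z = eval_fps (complex_fps l) (z\<^sup>2)"
  using sums_compose_square[of l x] sums_compose_square[of l z]
  by (simp_all add: eval_fps_def suminf_def)

lemma fps_conv_radius_compose_square:
  fixes l :: "real fps"
  assumes "fps_conv_radius l = \<infinity>"
  shows "fps_conv_radius (l oo fps_X ^ 2) = \<infinity>"
  unfolding fps_conv_radius_def
proof (rule conv_radius_inftyI'')
  fix x :: real
  have "(\<lambda>n. fps_nth l n * (x\<^sup>2) ^ n) sums eval_fps l (x\<^sup>2)"
    using assms by (intro sums_eval_fps) simp
  then show "summable (\<lambda>n. fps_nth (l oo fps_X ^ 2) n * x ^ n)"
    using sums_compose_square[of l x] by (auto simp: summable_def)
qed

lemma wright_entire_log_deriv: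
  assumes "\<rho> > 0" "\<beta> > 0"
  obtains T where "entire_log_deriv (wright_fps \<rho> \<beta>) T 1"
proof -
  obtain S where S: "fps_nth (wright_fps \<rho> \<beta>) 0 > 0" "nonneg_fps S"
    "fps_X * fps_deriv (wright_fps \<rho> \<beta>) = - (S * wright_fps \<rho> \<beta>)"
    using nonneg_log_derivE[OF nonneg_log_deriv_wright_fps[OF assms]] by metis
  \<comment> \<open>This coefficient is \<open>- 1 / \<Gamma>(\<rho> + \<beta>)\<close>; were
    \<open>S\<close> zero, the series would be constant.\<close>
  have "fps_nth (wright_fps \<rho> \<beta>) 1 \<noteq> 0"
    using assms less_imp_neq[OF Gamma_real_pos[of "\<rho> + \<beta>"]] by (simp add: wright_fps_def)
  then have "S \<noteq> 0"
    using arg_cong[OF S(3), of "\<lambda>f. fps_nth f 1"] by auto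
  then have "entire_log_deriv (wright_fps \<rho> \<beta>) S 1"
    using S fps_conv_radius_wright_fps[OF assms(1)] by unfold_locales simp_all
  then show ?thesis by (rule that)
qed

lemma wright_square_entire_log_deriv:
  assumes "\<rho> > 0" "\<beta> > 0" "\<gamma> > 0"
  obtains T where "entire_log_deriv (wright_fps \<rho> \<beta> oo fps_X ^ 2) T \<gamma>"
proof -
  obtain S where "entire_log_deriv (wright_fps \<rho> \<beta>) S 1"
    using wright_entire_log_deriv[OF assms(1,2)] .
  then interpret S: entire_log_deriv "wright_fps \<rho> \<beta>" S 1 .
  \<comment> \<open>The chain rule for the square contributes the factor 2, and the division by
    \<gamma> cancels the \<gamma> in the locale equation.\<close>
  define T where "T = fps_const (2 / \<gamma>) * (S oo fps_X ^ 2)"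
  have "fps_X * fps_deriv (wright_fps \<rho> \<beta> oo fps_X ^ 2) =
      fps_const 2 * (fps_X ^ 2 * (fps_deriv (wright_fps \<rho> \<beta>) oo fps_X ^ 2))"
    by (simp add: fps_compose_deriv fps_deriv_power power2_eq_square numeral_fps_const mult_ac)
  also have "fps_X ^ 2 * (fps_deriv (wright_fps \<rho> \<beta>) oo fps_X ^ 2) =
      (fps_X * fps_deriv (wright_fps \<rho> \<beta>)) oo fps_X ^ 2"
    by (simp add: fps_compose_mult_distrib)
  also have "\<dots> = - ((S oo fps_X ^ 2) * (wright_fps \<rho> \<beta> oo fps_X ^ 2))"
    unfolding S.T_eq by (simp add: fps_compose_mult_distrib fps_compose_uminus)
  also have "S oo fps_X ^ 2 = fps_const (\<gamma> / 2) * T"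
    using assms by (simp add: T_def mult.assoc[symmetric])
  finally have eq: "fps_X * fps_deriv (wright_fps \<rho> \<beta> oo fps_X ^ 2) =
      - (fps_const \<gamma> * T * (wright_fps \<rho> \<beta> oo fps_X ^ 2))"
    by (simp add: mult.assoc[symmetric])
  have "nonneg_fps T"
    unfolding T_def using assms S.T_nonneg
    by (intro nonneg_fps_mult nonneg_fps_const nonneg_fps_compose nonneg_fps_power nonneg_fps_X) auto
  moreover have "T \<noteq> 0"
  proof -
    obtain k where "fps_nth S k \<noteq> 0"
      using S.T_nonzero by (auto simp: fps_eq_iff)
    then have "fps_nth T (2 * k) \<noteq> 0"
      using assms by (simp add: T_def)
    then show ?thesis by auto
  qed
  ultimately have "entire_log_deriv (wright_fps \<rho> \<beta> oo fps_X ^ 2) T \<gamma>"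
    using assms eq S.e_entire S.e_pos fps_conv_radius_compose_square by unfold_locales simp_all
  then show ?thesis by (rule that)
qed

lemma wright_minus:
  "wright \<rho> \<beta> (- z) = (\<Sum>n. of_real (fps_nth (wright_fps \<rho> \<beta>) n) * z ^ n)"
proof -
  have "(- z) ^ n / (fact n * of_real (Gamma (real n * \<rho> + \<beta>))) =
    of_real (fps_nth (wright_fps \<rho> \<beta>) n) * z ^ n" for n
    by (subst power_minus) (simp add: wright_fps_def)
  then show ?thesis
    by (simp add: wright_def)
qed

lemma wright_eq_eval_fps:
  "wright \<rho> \<beta> (- z) = eval_fps (complex_fps (wright_fps \<rho> \<beta>)) z"
  "wright \<rho> \<beta> (- x) = eval_fps (wright_fps \<rho> \<beta>) x"
  by (simp_all add: wright_minus eval_fps_def)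

theorem theorem5:
  fixes \<rho> \<beta> \<alpha> :: real
  assumes "\<rho> > 0" and "\<beta> > 0" and "0 \<le> \<alpha>" and "\<alpha> < 1"
  shows
    "(\<exists>r. convexity_radius \<alpha> (wright_f \<rho> \<beta>) = ereal r \<and>
       smallest_positive (\<lambda>r. wright_Psi \<rho> \<beta> r \<noteq> 0 \<and> deriv (wright_Psi \<rho> \<beta>) r \<noteq> 0 \<and>
         1 + r * deriv (deriv (wright_Psi \<rho> \<beta>)) r / deriv (wright_Psi \<rho> \<beta>) r
           + (1 / \<beta> - 1) * (r * deriv (wright_Psi \<rho> \<beta>) r / wright_Psi \<rho> \<beta> r) = \<alpha>) r) \<and>
     (\<exists>r. convexity_radius \<alpha> (wright_g \<rho> \<beta>) = ereal r \<and>
       smallest_positive (\<lambda>r. deriv (wright_g \<rho> \<beta>) (of_real r) \<noteq> 0 \<and>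
         1 + of_real r * deriv (deriv (wright_g \<rho> \<beta>)) (of_real r)
               / deriv (wright_g \<rho> \<beta>) (of_real r) = of_real \<alpha>) r) \<and>
     (\<exists>r. convexity_radius \<alpha> (wright_h \<rho> \<beta>) = ereal r \<and>
       smallest_positive (\<lambda>r. deriv (wright_h \<rho> \<beta>) (of_real r) \<noteq> 0 \<and>
         1 + of_real r * deriv (deriv (wright_h \<rho> \<beta>)) (of_real r)
               / deriv (wright_h \<rho> \<beta>) (of_real r) = of_real \<alpha>) r)"
proof -
  define E :: "complex \<Rightarrow> complex" where "E = eval_fps (complex_fps (wright_fps \<rho> \<beta>))"
  \<comment> \<open>The constant coefficient of the Wright series is
    \<open>1 / \<Gamma>(\<beta>)\<close>, so the normalising factor is division by
    \<open>e(0)\<close>.\<close>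
  have Gamma: "w * complex_of_real (Gamma \<beta>) = w / of_real (fps_nth (wright_fps \<rho> \<beta>) 0)" for w
    by (simp add: wright_fps_def)
  \<comment> \<open>The functions \<open>f\<close> and \<open>g\<close> share the series in the
    square and differ in the exponent, \<beta> against 1; \<open>h\<close> uses the series itself
    with exponent 1.\<close>
  obtain T1 where "entire_log_deriv (wright_fps \<rho> \<beta> oo fps_X ^ 2) T1 \<beta>"
    using wright_square_entire_log_deriv[OF assms(1,2,2)] .
  then interpret f: entire_log_deriv "wright_fps \<rho> \<beta> oo fps_X ^ 2" T1 \<beta> .
  obtain T2 where "entire_log_deriv (wright_fps \<rho> \<beta> oo fps_X ^ 2) T2 1"
    using wright_square_entire_log_deriv[OF assms(1,2), of 1] by auto
  then interpret g: entire_log_deriv "wright_fps \<rho> \<beta> oo fps_X ^ 2" T2 1 .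
  obtain T3 where "entire_log_deriv (wright_fps \<rho> \<beta>) T3 1"
    using wright_entire_log_deriv[OF assms(1,2)] .
  then interpret h: entire_log_deriv "wright_fps \<rho> \<beta>" T3 1 .
  have "wright_f \<rho> \<beta> z = z * (E (z\<^sup>2) / of_real (fps_nth (wright_fps \<rho> \<beta>) 0)) powr of_real (1 / \<beta>)" for z
    by (simp add: wright_f_def wright_eq_eval_fps E_def Gamma[symmetric] mult.commute)
  then have f: "\<forall>\<^sub>F z in nhds 0. wright_f \<rho> \<beta> z = f.F z"
    using f.F_eq_power by (simp add: eval_fps_compose_square E_def)
  have Psi: "wright_Psi \<rho> \<beta> x = x powr \<beta> * eval_fps (wright_fps \<rho> \<beta> oo fps_X ^ 2) x" for x
    by (simp add: wright_Psi_def wright_lambda_def wright_eq_eval_fps eval_fps_compose_square)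
  have g: "wright_g \<rho> \<beta> z = g.F z" if "ereal (norm z) < g.R" for z
  proof -
    have "wright_g \<rho> \<beta> z = z * (E (z\<^sup>2) / of_real (fps_nth (wright_fps \<rho> \<beta>) 0))"
      by (simp add: wright_g_def wright_eq_eval_fps E_def Gamma[symmetric] mult_ac)
    then show ?thesis
      using g.F_eq[OF refl that] by (simp add: eval_fps_compose_square E_def)
  qed
  have h: "wright_h \<rho> \<beta> z = h.F z" if "ereal (norm z) < h.R" for z
  proof -
    have "wright_h \<rho> \<beta> z = z * (E z / of_real (fps_nth (wright_fps \<rho> \<beta>) 0))"
      by (simp add: wright_h_def wright_eq_eval_fps E_def Gamma[symmetric] mult_ac)
    then show ?thesis
      using h.F_eq[OF refl that] by (simp add: E_def)
  qed
  show ?thesis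
    using f.Psi_root[OF f Psi assms(3,4)] g.deriv_of_real_root[OF g assms(3,4)]
      h.deriv_of_real_root[OF h assms(3,4)] by blast
qed

end
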